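(* For every integer $t\geq 3$ we have $$M_{K_t}(n)\leq\Big(\frac{t-3}{t-2}+o(1)\Big)\binom{n}{2},$$ that is, for every $\varepsilon>0$ there is $n_0$ such that $M_{K_t}(n)\leq\big(\frac{t-3}{t-2}+\varepsilon\big)\binom{n}{2}$ for all integers $n\geq n_0$. Here $K_t$ denotes the complete graph on $t$ vertices.
   Context: For $k$-uniform hypergraphs ($k$-graphs) $F$ and $H$, a copy of $F$ in $H$ is a subhypergraph of $H$ isomorphic to $F$, and $c(F,H)$ denotes the number of copies of $F$ in $H$. For $e\in V(H)^{(k)}$ (the set of $k$-element subsets of $V(H)$), $H\cup e$ denotes the $k$-graph $(V(H),E(H)\cup\{e\})$. The $F$-bootstrap percolation process ($F$-process) starting with $H$ is the sequence $(H_i)_{i\geq 0}$ with $H_0=H$ and $H_{i+1}$ the $k$-graph on $V(H)$ with edge set $E(H_i)\cup\{e\in V(H)^{(k)}: c(F,H_i\cup e)>c(F,H_i)\}$. The running time is $\tau_F(H)=\min\{t\in\mathbb{N}_{\geq 0}: H_t=H_{t+1}\}$, and $M_F(n)=\max\{\tau_F(H): H \text{ a } k\text{-graph on } n \text{ vertices}\}$. Here graphs are $2$-graphs. *)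

theory Defs
  imports Complex_Main "HOL-Library.Ramsey"
begin

text \<open>A hypergraph is a pair of a vertex set and an edge set. The set of \<open>k\<close>-element
  subsets of \<open>V\<close> is \<^term>\<open>nsets V k\<close>.\<close>

type_synonym 'a hypergraph = "'a set \<times> 'a set set"

abbreviation verts :: "'a hypergraph \<Rightarrow> 'a set" where
  "verts H \<equiv> fst H"

abbreviation edges :: "'a hypergraph \<Rightarrow> 'a set set" where
  "edges H \<equiv> snd H"

definition kgraph :: "nat \<Rightarrow> 'a hypergraph \<Rightarrow> bool" where
  "kgraph k H \<longleftrightarrow> finite (verts H) \<and> edges H \<subseteq> nsets (verts H) k"

definition subhypergraph :: "'a hypergraph \<Rightarrow> 'a hypergraph \<Rightarrow> bool" where
  "subhypergraph G H \<longleftrightarrow>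
     verts G \<subseteq> verts H \<and> edges G \<subseteq> edges H \<and> (\<forall>e\<in>edges G. e \<subseteq> verts G)"

definition isomorphic :: "'b hypergraph \<Rightarrow> 'a hypergraph \<Rightarrow> bool" where
  "isomorphic F G \<longleftrightarrow>
     (\<exists>f. bij_betw f (verts F) (verts G) \<and> edges G = (\<lambda>e. f ` e) ` edges F)"

definition copies :: "'b hypergraph \<Rightarrow> 'a hypergraph \<Rightarrow> 'a hypergraph set" where
  "copies F H = {G. subhypergraph G H \<and> isomorphic F G}"

definition num_copies :: "'b hypergraph \<Rightarrow> 'a hypergraph \<Rightarrow> nat" where
  "num_copies F H = card (copies F H)"

definition add_edge :: "'a hypergraph \<Rightarrow> 'a set \<Rightarrow> 'a hypergraph" where
  "add_edge H e = (verts H, insert e (edges H))"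

definition bootstrap_step :: "nat \<Rightarrow> 'b hypergraph \<Rightarrow> 'a hypergraph \<Rightarrow> 'a hypergraph" where
  "bootstrap_step k F H =
     (verts H, edges H \<union> {e \<in> nsets (verts H) k. num_copies F (add_edge H e) > num_copies F H})"

definition bootstrap_process ::
    "nat \<Rightarrow> 'b hypergraph \<Rightarrow> 'a hypergraph \<Rightarrow> nat \<Rightarrow> 'a hypergraph" where
  "bootstrap_process k F H i = (bootstrap_step k F ^^ i) H"

definition running_time :: "nat \<Rightarrow> 'b hypergraph \<Rightarrow> 'a hypergraph \<Rightarrow> nat" where
  "running_time k F H =
     (LEAST t. bootstrap_process k F H t = bootstrap_process k F H (Suc t))"

text \<open>Every finite hypergraph is isomorphic to one whose vertices are natural numbers, so nothing
  is lost by taking \<open>H\<close> over \<^typ>\<open>nat\<close>. The set of running times is finite, since the process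
  is increasing and hence \<^prop>\<open>running_time k F H \<le> n choose k\<close>; so \<open>Max\<close> is a genuine
  maximum.\<close>

definition max_running_time :: "nat \<Rightarrow> 'b hypergraph \<Rightarrow> nat \<Rightarrow> nat" where
  "max_running_time k F n =
     Max {running_time k F H | H :: nat hypergraph. kgraph k H \<and> card (verts H) = n}"

definition complete_graph :: "nat \<Rightarrow> nat hypergraph" where
  "complete_graph t = ({..<t}, nsets {..<t} 2)"

end

theory Submission
  imports Defs "HOL-Analysis.Convex"
begin

text \<open>Choose one newly infected edge from every step and label it with its infection time; let \<open>G\<close>
  be the graph of these edges. If all pairs but one of a \<open>t\<close>-set lie in \<open>G\<close>, then the last infected
  pair of this set follows the last but one within one step. So the set contains two pairs, one of
  them in \<open>G\<close>, whose labels differ by at most \<open>1\<close>. As the labels are distinct on \<open>G\<close>, only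
  \<open>O(n\<^sup>t\<^sup>-\<^sup>1)\<close> sets have this property. On the other hand, if the density of \<open>G\<close> exceeds the
  threshold \<open>1 - 1 / (t - 2)\<close> by a constant, then the Moon-Moser inequalities and convexity give
  \<open>\<Omega>(n\<^sup>t)\<close> copies in \<open>G\<close> of \<open>K\<^sub>t\<close> minus an edge.\<close>

section \<open>Cliques, common neighbours and double counting\<close>

definition cliques :: "'a set \<Rightarrow> 'a set set \<Rightarrow> nat \<Rightarrow> 'a set set" where
  "cliques V G r = {A \<in> nsets V r. nsets A 2 \<subseteq> G}"

definition common_nbrs :: "'a set \<Rightarrow> 'a set set \<Rightarrow> 'a set \<Rightarrow> 'a set" where
  "common_nbrs V G A = {x \<in> V. \<forall>y\<in>A. {x, y} \<in> G}"

lemma finite_cliques: "finite V \<Longrightarrow> finite (cliques V G r)"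
  by (simp add: cliques_def finite_imp_finite_nsets)

lemma finite_common_nbrs: "finite V \<Longrightarrow> finite (common_nbrs V G A)"
  by (simp add: common_nbrs_def)

lemma common_nbrs_notin: "G \<subseteq> nsets V 2 \<Longrightarrow> x \<in> common_nbrs V G A \<Longrightarrow> x \<notin> A"
  by (force simp: common_nbrs_def nsets_def)

lemma insert_in_cliques:
  assumes "G \<subseteq> nsets V 2" "A \<in> cliques V G r" "x \<in> common_nbrs V G A"
  shows "insert x A \<in> cliques V G (Suc r)"
proof -
  have "x \<notin> A" using assms common_nbrs_notin by metis
  then have "insert x A \<in> nsets V (Suc r)"
    using assms by (auto simp: cliques_def common_nbrs_def nsets_def)
  moreover have "nsets (insert x A) 2 \<subseteq> G"
  proof
    fix e assume "e \<in> nsets (insert x A) 2"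
    then obtain a b where ab: "e = {a, b}" "a \<noteq> b" "a \<in> insert x A" "b \<in> insert x A"
      by (auto simp: nsets_def card_2_iff)
    show "e \<in> G"
    proof (cases "a = x \<or> b = x")
      case True
      then show ?thesis using ab assms(3) by (auto simp: common_nbrs_def insert_commute)
    next
      case False
      then have "e \<in> nsets A 2" using ab by (auto simp: nsets_def)
      then show ?thesis using assms(2) by (auto simp: cliques_def)
    qed
  qed
  ultimately show ?thesis by (simp add: cliques_def)
qed

lemma remove_in_cliques:
  assumes "Q \<in> cliques V G (Suc r)" "q \<in> Q"
  shows "Q - {q} \<in> cliques V G r" "q \<in> common_nbrs V G (Q - {q})"
proof -
  have "nsets (Q - {q}) 2 \<subseteq> nsets Q 2" by (auto simp: nsets_def)
  moreover have "Q - {q} \<in> nsets V r" using assms by (auto simp: cliques_def nsets_def)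
  ultimately show "Q - {q} \<in> cliques V G r"
    using assms unfolding cliques_def by blast
  have "{q, y} \<in> nsets Q 2" if "y \<in> Q - {q}" for y
    using that assms by (auto simp: nsets_def)
  moreover have "nsets Q 2 \<subseteq> G" "q \<in> V"
    using assms by (auto simp: cliques_def nsets_def)
  ultimately show "q \<in> common_nbrs V G (Q - {q})"
    unfolding common_nbrs_def by blast
qed

text \<open>Double counting: an \<open>r\<close>-clique \<open>A\<close> with a common neighbour
  \<open>x\<close> is the same as the clique \<open>insert x A\<close> with the marked vertex
  \<open>x\<close>. Deleting the marked vertex is the inverse map.\<close>

lemma sum_cliques_Suc:
  fixes f :: "'a set \<Rightarrow> 'a \<Rightarrow> real"
  assumes V: "finite V" and G: "G \<subseteq> nsets V 2"
  shows "(\<Sum>Q\<in>cliques V G (Suc r). \<Sum>q\<in>Q. f (Q - {q}) q)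
    = (\<Sum>A\<in>cliques V G r. \<Sum>x\<in>common_nbrs V G A. f A x)"
proof -
  have fin: "finite Q" if "Q \<in> cliques V G s" for Q s
    using that by (auto simp: cliques_def nsets_def)
  have "(\<Sum>Q\<in>cliques V G (Suc r). \<Sum>q\<in>Q. f (Q - {q}) q)
      = (\<Sum>(Q, q)\<in>(SIGMA Q:cliques V G (Suc r). Q). f (Q - {q}) q)"
    using V by (intro sum.Sigma) (auto simp: finite_cliques fin)
  also have "\<dots> = (\<Sum>(A, x)\<in>(SIGMA A:cliques V G r. common_nbrs V G A). f A x)"
    using common_nbrs_notin[OF G] insert_in_cliques[OF G] remove_in_cliques
    by (intro sum.reindex_bij_witness[where i="\<lambda>(A, x). (insert x A, x)"
          and j="\<lambda>(Q, q). (Q - {q}, q)"]) fastforce+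
  also have "\<dots> = (\<Sum>A\<in>cliques V G r. \<Sum>x\<in>common_nbrs V G A. f A x)"
    using V by (intro sum.Sigma[symmetric]) (auto simp: finite_cliques finite_common_nbrs)
  finally show ?thesis .
qed

text \<open>The case of constant weight \<open>1\<close>: each clique of size \<open>Suc r\<close>
  has \<open>r + 1\<close> choices for its marked vertex.\<close>

lemma card_cliques_Suc:
  assumes V: "finite V" and G: "G \<subseteq> nsets V 2"
  shows "(\<Sum>A\<in>cliques V G r. real (card (common_nbrs V G A)))
    = (real r + 1) * real (card (cliques V G (Suc r)))"
proof -
  have "(\<Sum>A\<in>cliques V G r. real (card (common_nbrs V G A)))
      = (\<Sum>Q\<in>cliques V G (Suc r). \<Sum>q\<in>Q. 1)"
    using sum_cliques_Suc[OF V G, of "\<lambda>_ _. 1" r] by simp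
  also have "\<dots> = (\<Sum>Q\<in>cliques V G (Suc r). real r + 1)"
    by (intro sum.cong) (auto simp: cliques_def nsets_def)
  finally show ?thesis by simp
qed

text \<open>Count by the vertex \<open>v\<close>. If \<open>v\<close> is joined to all of
  \<open>Q\<close>, it contributes at most \<open>r + 1\<close>. Otherwise it misses some
  \<open>y\<close> in \<open>Q\<close> and can be counted only when \<open>y\<close> is the removed
  vertex, so it contributes at most \<open>1\<close>.\<close>

lemma sum_common_nbrs_remove_le:
  assumes V: "finite V" and Q: "finite Q" "card Q = Suc r"
  shows "(\<Sum>q\<in>Q. real (card (common_nbrs V G (Q - {q}))))
    \<le> real (card V) + real r * real (card (common_nbrs V G Q))"
proof -
  define N where "N v = {q \<in> Q. v \<in> common_nbrs V G (Q - {q})}" for v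
  have "(\<Sum>q\<in>Q. real (card (common_nbrs V G (Q - {q}))))
      = (\<Sum>q\<in>Q. \<Sum>v\<in>V. of_bool (v \<in> common_nbrs V G (Q - {q})))"
    using V by (intro sum.cong refl) (auto simp: sum.If_cases of_bool_def common_nbrs_def
        intro!: arg_cong[where f=card])
  also have "\<dots> = (\<Sum>v\<in>V. \<Sum>q\<in>Q. of_bool (v \<in> common_nbrs V G (Q - {q})))"
    by (rule sum.swap)
  also have "\<dots> = (\<Sum>v\<in>V. real (card (N v)))"
    using Q by (intro sum.cong refl) (auto simp: sum.If_cases of_bool_def N_def
        intro!: arg_cong[where f=card])
  also have "\<dots> \<le> (\<Sum>v\<in>V. 1 + real r * of_bool (v \<in> common_nbrs V G Q))"
  proof (intro sum_mono)
    fix v assume v: "v \<in> V"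
    show "real (card (N v)) \<le> 1 + real r * of_bool (v \<in> common_nbrs V G Q)"
    proof (cases "v \<in> common_nbrs V G Q")
      case True
      have "card (N v) \<le> card Q" using Q by (intro card_mono) (auto simp: N_def)
      then show ?thesis using True Q by simp
    next
      case False
      then obtain y where "y \<in> Q" "{v, y} \<notin> G" using v by (auto simp: common_nbrs_def)
      then have "N v \<subseteq> {y}" by (auto simp: N_def common_nbrs_def)
      then have "card (N v) \<le> card {y}" by (intro card_mono) auto
      then show ?thesis by simp
    qed
  qed
  also have "\<dots> = real (card V) + real r * real (card (common_nbrs V G Q))"
  proof -
    have "V \<inter> {v. v \<in> common_nbrs V G Q} = common_nbrs V G Q"
      by (auto simp: common_nbrs_def)
    then show ?thesis using V
      by (simp add: sum.distrib flip: sum_distrib_left)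
  qed
  finally show ?thesis .
qed

text \<open>Cauchy-Schwarz, the convexity half of the Moon-Moser inequality.\<close>

lemma sum_power2_common_nbrs_ge:
  assumes V: "finite V"
  shows "(\<Sum>A\<in>cliques V G r. real (card (common_nbrs V G A)))\<^sup>2
    \<le> real (card (cliques V G r)) * (\<Sum>A\<in>cliques V G r. (real (card (common_nbrs V G A)))\<^sup>2)"
  using sum_squared_le_sum_of_squares[of "\<lambda>A. real (card (common_nbrs V G A))" "cliques V G r"]
    finite_cliques[OF V] by (simp add: mult.commute)

text \<open>The combinatorial half: a square is its base summed once per common neighbour, so
  \<open>sum_cliques_Suc\<close> regroups the sum over cliques of size \<open>Suc r\<close>, where
  the previous pointwise bound applies.\<close>

lemma sum_power2_common_nbrs_le:
  assumes V: "finite V" and G: "G \<subseteq> nsets V 2"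
  shows "(\<Sum>A\<in>cliques V G r. (real (card (common_nbrs V G A)))\<^sup>2)
    \<le> real (card V) * real (card (cliques V G (Suc r)))
      + real r * (\<Sum>Q\<in>cliques V G (Suc r). real (card (common_nbrs V G Q)))"
proof -
  have "(\<Sum>A\<in>cliques V G r. (real (card (common_nbrs V G A)))\<^sup>2)
      = (\<Sum>A\<in>cliques V G r. \<Sum>x\<in>common_nbrs V G A. real (card (common_nbrs V G A)))"
    by (simp add: power2_eq_square)
  also have "\<dots> = (\<Sum>Q\<in>cliques V G (Suc r). \<Sum>q\<in>Q. real (card (common_nbrs V G (Q - {q}))))"
    by (rule sum_cliques_Suc[OF V G, symmetric])
  also have "\<dots> \<le> (\<Sum>Q\<in>cliques V G (Suc r).
      real (card V) + real r * real (card (common_nbrs V G Q)))"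
    by (intro sum_mono sum_common_nbrs_remove_le V) (auto simp: cliques_def nsets_def)
  finally show ?thesis by (simp add: sum.distrib sum_distrib_left mult.commute)
qed

section \<open>Clique counts above the threshold density\<close>

lemma cliques_1: "cliques V G 1 = (\<lambda>x. {x}) ` V"
proof -
  have "nsets {x} 2 = {}" for x :: 'a
    by (auto simp: nsets_def card_2_iff subset_singleton_iff)
  then show ?thesis by (auto simp: cliques_def nsets_def card_1_singleton_iff)
qed

lemma cliques_2:
  assumes "G \<subseteq> nsets V 2"
  shows "cliques V G 2 = G"
proof -
  have "nsets A 2 = {A}" if "card A = 2" for A :: "'a set"
  proof -
    have "finite A" using that by (simp add: card_ge_0_finite)
    then have "B \<subseteq> A \<and> finite B \<and> card B = 2 \<longleftrightarrow> B = A" for B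
      using that card_subset_eq[of A B] by auto
    then show ?thesis by (auto simp only: nsets_def)
  qed
  then have "nsets A 2 = {A}" if "A \<in> nsets V 2" for A
    using that by (simp add: nsets_def)
  then have "A \<in> cliques V G 2 \<longleftrightarrow> A \<in> nsets V 2 \<and> A \<in> G" for A
    by (simp add: cliques_def cong: conj_cong)
  then show ?thesis using assms by blast
qed

text \<open>With \<open>D r\<close> the average number of common neighbours of an \<open>r\<close>-clique, divided by \<open>n\<close>, the
  Cauchy-Schwarz inequality gives \<open>r * D (r - 1) \<le> 1 + (r - 1) * D r\<close>, hence
  \<open>1 - D r \<le> r * (1 - D 1)\<close>.\<close>

lemma Moon_Moser_density:
  assumes V: "finite V" "V \<noteq> {}" and G: "G \<subseteq> nsets V 2"
    and R: "1 \<le> R" and \<delta>: "\<delta> > 0"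
    and dens: "2 * real (card G) \<ge> (1 - 1 / real R + \<delta>) * (real (card V))\<^sup>2"
    and r: "1 \<le> r" "r \<le> R"
  shows "0 < card (cliques V G r) \<and> (1 - real r * (1 / real R - \<delta>)) * real (card V)
      * real (card (cliques V G r)) \<le> (real r + 1) * real (card (cliques V G (Suc r)))"
  using r
proof (induction r rule: dec_induct)
  case base
  have "card (cliques V G 1) = card V"
    unfolding cliques_1 by (intro card_image) auto
  then show ?case using dens V cliques_2[OF G]
    by (simp add: power2_eq_square numeral_2_eq_2 card_gt_0_iff algebra_simps)
next
  case (step r)
  define n k k' k'' where "n = real (card V)" and "k = real (card (cliques V G r))"
    and "k' = real (card (cliques V G (Suc r)))" and "k'' = real (card (cliques V G (Suc (Suc r))))"
  \<comment> \<open>\<open>b\<close> bounds \<open>1 - D 1\<close> from above, and the claim at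
    \<open>r\<close> reads \<open>D r \<ge> 1 - r * b\<close>.\<close>
  define b where "b = 1 / real R - \<delta>"
  have n: "n > 0" using V by (simp add: n_def card_gt_0_iff)
  have IH: "k > 0" "(1 - real r * b) * n * k \<le> (real r + 1) * k'"
    using step by (auto simp: k_def k'_def n_def b_def)
  \<comment> \<open>This makes the lower bound in the induction hypothesis positive, so cliques of
    size \<open>Suc r\<close> exist and \<open>D (r + 1)\<close> makes sense.\<close>
  have "real r * b < 1"
  proof -
    have "real r * b < real r * (1 / real R)" using step \<delta> unfolding b_def
      by (intro mult_strict_left_mono) auto
    also have "\<dots> \<le> 1" using step R by simp
    finally show ?thesis .
  qed
  then have "0 < (1 - real r * b) * n * k" using n IH by simp
  then have k': "k' > 0" using IH(2) by (smt (verit) mult_nonneg_nonpos of_nat_0_le_iff)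
  have "((real r + 1) * k')\<^sup>2 \<le> k * (n * k' + real r * ((real r + 2) * k''))"
    using order_trans[OF sum_power2_common_nbrs_ge[OF V(1), of G r]
        mult_left_mono[OF sum_power2_common_nbrs_le[OF V(1) G, of r]]]
    unfolding card_cliques_Suc[OF V(1) G] k_def k'_def k''_def n_def
    by (simp add: add.commute add.left_commute)
  \<comment> \<open>Only one factor of the square is replaced by the induction hypothesis. This
    produces a factor \<open>k\<close> that cancels, and leaves a \<open>k'\<close> in the other
    factor.\<close>
  moreover have "((1 - real r * b) * n * k) * ((real r + 1) * k') \<le> ((real r + 1) * k')\<^sup>2"
    unfolding power2_eq_square using IH k' by (intro mult_right_mono) auto
  ultimately have "k * ((1 - real r * b) * n * ((real r + 1) * k'))
      \<le> k * (n * k' + real r * ((real r + 2) * k''))"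
    by (simp add: algebra_simps)
  then have "(1 - real r * b) * n * ((real r + 1) * k') \<le> n * k' + real r * ((real r + 2) * k'')"
    using IH by simp
  then have "real r * ((1 - (real r + 1) * b) * n * k') \<le> real r * ((real r + 2) * k'')"
    by (simp add: algebra_simps)
  then have "(1 - (real r + 1) * b) * n * k' \<le> (real r + 2) * k''"
    using step by simp
  then show ?case using k'
    by (simp add: k'_def k''_def b_def n_def add.commute add.left_commute)
qed

text \<open>For \<open>1 \<le> r \<le> R\<close> the Moon-Moser factor
  \<open>1 - r * (1 / R - \<delta>)\<close> is at least \<open>r * \<delta>\<close>, hence at least
  \<open>\<delta>\<close>. So an \<open>r\<close>-clique has on average at least
  \<open>\<delta> * n\<close> common neighbours; iterating from the \<open>n\<close> single vertices
  gives the first bound.\<close>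

lemma card_cliques_ge:
  assumes V: "finite V" "V \<noteq> {}" and G: "G \<subseteq> nsets V 2"
    and R: "1 \<le> R" and \<delta>: "\<delta> > 0"
    and dens: "2 * real (card G) \<ge> (1 - 1 / real R + \<delta>) * (real (card V))\<^sup>2"
    and r: "1 \<le> r" "r \<le> R"
  shows "real (card V) * (\<delta> * real (card V)) ^ (r - 1) \<le> fact r * real (card (cliques V G r))"
    and "\<delta> * real (card V) * real (card (cliques V G r))
      \<le> (real r + 1) * real (card (cliques V G (Suc r)))"
proof -
  have density: "\<delta> * real (card V) * real (card (cliques V G r))
      \<le> (real r + 1) * real (card (cliques V G (Suc r)))" if "1 \<le> r" "r \<le> R" for r
  proof -
    have "real r * (1 / real R) \<le> 1" "\<delta> \<le> real r * \<delta>" using that \<delta> R by auto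
    then have "\<delta> \<le> 1 - real r * (1 / real R - \<delta>)" by (simp add: algebra_simps)
    then have "\<delta> * (real (card V) * real (card (cliques V G r)))
        \<le> (1 - real r * (1 / real R - \<delta>)) * (real (card V) * real (card (cliques V G r)))"
      by (intro mult_right_mono) auto
    with Moon_Moser_density[OF assms(1-6) that] show ?thesis by (simp add: mult.assoc)
  qed
  show "\<delta> * real (card V) * real (card (cliques V G r))
      \<le> (real r + 1) * real (card (cliques V G (Suc r)))" using density r .
  show "real (card V) * (\<delta> * real (card V)) ^ (r - 1) \<le> fact r * real (card (cliques V G r))"
    using r
  proof (induction r rule: dec_induct)
    case base
    have "card (cliques V G 1) = card V"
      unfolding cliques_1 by (intro card_image) auto
    then show ?case by simp
  next
    case (step r)
    have "real (card V) * (\<delta> * real (card V)) ^ (Suc r - 1)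
        = (\<delta> * real (card V)) * (real (card V) * (\<delta> * real (card V)) ^ (r - 1))"
      using step by (cases r) auto
    also have "\<dots> \<le> (\<delta> * real (card V)) * (fact r * real (card (cliques V G r)))"
      using step \<delta> by (intro mult_left_mono) auto
    also have "\<dots> = fact r * (\<delta> * real (card V) * real (card (cliques V G r)))" by simp
    also have "\<dots> \<le> fact r * ((real r + 1) * real (card (cliques V G (Suc r))))"
      using step density by (intro mult_left_mono) auto
    finally show ?case by (simp add: algebra_simps)
  qed
qed

text \<open>The sum counts triples of an \<open>R\<close>-clique and two common neighbours, which
  for distinct neighbours span \<open>K_(R+2)\<close> with at most one edge missing. There are order
  \<open>n ^ R\<close> cliques with average at least \<open>\<delta> * n\<close>, and by convexity
  squaring only helps.\<close>

lemma sum_power2_common_nbrs_lower: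
  assumes V: "finite V" "V \<noteq> {}" and G: "G \<subseteq> nsets V 2"
    and R: "1 \<le> R" and \<delta>: "\<delta> > 0"
    and dens: "2 * real (card G) \<ge> (1 - 1 / real R + \<delta>) * (real (card V))\<^sup>2"
  shows "\<delta> ^ (R + 1) * real (card V) ^ (R + 2)
    \<le> fact R * (\<Sum>A\<in>cliques V G R. (real (card (common_nbrs V G A)))\<^sup>2)"
proof -
  define n k S where "n = real (card V)" and "k = real (card (cliques V G R))"
    and "S = (\<Sum>A\<in>cliques V G R. (real (card (common_nbrs V G A)))\<^sup>2)"
  have n: "n > 0" using V by (simp add: n_def card_gt_0_iff)
  have k: "k > 0" using Moon_Moser_density[OF assms R order_refl] by (simp add: k_def)
  have "(\<delta> * n * k)\<^sup>2 \<le> ((real R + 1) * real (card (cliques V G (Suc R))))\<^sup>2"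
    using card_cliques_ge(2)[OF assms R order_refl] n \<delta> k
    by (intro power_mono) (auto simp: n_def k_def)
  also have "\<dots> \<le> k * S"
    using sum_power2_common_nbrs_ge[OF V(1), of G R]
    unfolding card_cliques_Suc[OF V(1) G] k_def S_def .
  finally have "k * ((\<delta> * n)\<^sup>2 * k) \<le> k * S" by (simp add: power2_eq_square algebra_simps)
  then have S: "(\<delta> * n)\<^sup>2 * k \<le> S" using k by simp
  \<comment> \<open>Two factors \<open>\<delta> * n\<close> come from the squared average, the
    remaining \<open>R - 1\<close> from the number of \<open>R\<close>-cliques.\<close>
  have "\<delta> ^ (R + 1) * n ^ (R + 2) = (\<delta> * n)\<^sup>2 * (n * (\<delta> * n) ^ (R - 1))"
    using R by (cases R) (auto simp: power_mult_distrib power2_eq_square)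
  also have "\<dots> \<le> (\<delta> * n)\<^sup>2 * (fact R * k)"
    using card_cliques_ge(1)[OF assms R order_refl]
    by (intro mult_left_mono) (auto simp: n_def k_def)
  also have "\<dots> \<le> fact R * S" using S by (simp add: mult.left_commute)
  finally show ?thesis by (simp add: n_def S_def)
qed

section \<open>Sets containing two pairs with close labels\<close>

text \<open>Only \<open>e'\<close> has to lie in \<open>G\<close>, since \<open>e\<close> may be the
  one missing pair of a near-clique. Labels are injective on \<open>G\<close> only, so it is
  \<open>e'\<close> that is determined by \<open>e\<close> up to a bounded number of
  choices.\<close>

definition close_sets :: "'a set \<Rightarrow> 'a set set \<Rightarrow> ('a set \<Rightarrow> nat) \<Rightarrow> nat \<Rightarrow> 'a set set" where
  "close_sets V G \<tau> t = {Q \<in> nsets V t. \<exists>e\<in>nsets Q 2. \<exists>e'\<in>nsets Q 2 \<inter> G.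
     e \<noteq> e' \<and> \<tau> e \<le> \<tau> e' + 1 \<and> \<tau> e' \<le> \<tau> e + 1}"

lemma close_setsI:
  assumes "Q \<in> nsets V t" "e \<in> nsets Q 2" "e' \<in> nsets Q 2" "e' \<in> G" "e \<noteq> e'"
    "\<tau> e \<le> \<tau> e' + 1" "\<tau> e' \<le> \<tau> e + 1"
  shows "Q \<in> close_sets V G \<tau> t"
  using assms unfolding close_sets_def mem_Collect_eq by (intro conjI bexI[of _ e] bexI[of _ e'] IntI)

lemma choose_le_power: "n choose k \<le> n ^ k"
  by (cases "k \<le> n") (auto simp: binomial_le_pow binomial_eq_0)

text \<open>At most three edges of \<open>G\<close> have a label within \<open>1\<close> of \<open>\<tau> e\<close>, so once \<open>e\<close> is chosen there are
  at most six choices for a vertex of \<open>e' - e\<close>; this saves a factor \<open>n\<close>.\<close>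

lemma card_close_sets_le:
  assumes V: "finite V" and G: "G \<subseteq> nsets V 2" and inj: "inj_on \<tau> G" and t: "3 \<le> t"
  shows "card (close_sets V G \<tau> t) \<le> 6 * card V ^ (t - 1)"
proof -
  define N where "N e = {e' \<in> G. \<tau> e \<le> \<tau> e' + 1 \<and> \<tau> e' \<le> \<tau> e + 1}" for e
  define W where "W e = \<Union> (N e)" for e
  have finG: "finite G" using G V finite_imp_finite_nsets finite_subset by blast
  have finN: "finite (N e)" for e using finG by (simp add: N_def)
  have Ncard: "e' \<in> N e \<Longrightarrow> finite e' \<and> card e' = 2" for e e'
    using G by (auto simp: N_def nsets_def)
  have finW: "finite (W e)" for e using finN Ncard by (auto simp: W_def)
  have W: "card (W e) \<le> 6" for e
  proof -
    \<comment> \<open>For \<open>\<tau> e = 0\<close> the truncated subtraction only shortens the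
      interval, so three labels suffice in every case.\<close>
    have "card (N e) \<le> card {\<tau> e - 1..\<tau> e + 1}"
      using inj by (intro card_inj_on_le[of \<tau>]) (auto simp: N_def inj_on_def)
    then have N: "card (N e) \<le> 3" by simp
    have "card (W e) \<le> (\<Sum>e'\<in>N e. card e')"
      unfolding W_def using Ncard by (intro card_Union_le_sum_card)
    also have "\<dots> = (\<Sum>e'\<in>N e. 2)" using Ncard by (intro sum.cong) auto
    finally show ?thesis using N by simp
  qed
  \<comment> \<open>A close set is covered by \<open>e\<close>, a vertex \<open>w\<close> of
    \<open>e' - e\<close>, and the remaining \<open>t - 3\<close> vertices. The encoding need not be
    unique, as only an upper bound is wanted.\<close>
  let ?S = "SIGMA e:nsets V 2. W e \<times> nsets V (t - 3)"
  let ?f = "\<lambda>(e, w, P). insert w (e \<union> P)"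
  have finS: "finite ?S"
    using V finW by (intro finite_SigmaI finite_cartesian_product finite_imp_finite_nsets)
  have "close_sets V G \<tau> t \<subseteq> ?f ` ?S"
  proof
    fix Q assume "Q \<in> close_sets V G \<tau> t"
    then obtain e e' where Q: "Q \<subseteq> V" "finite Q" "card Q = t"
      and e: "e \<subseteq> Q" "finite e" "card e = 2" and e': "e' \<subseteq> Q" "finite e'" "card e' = 2" "e' \<in> G"
      and ne: "e \<noteq> e'" and close: "\<tau> e \<le> \<tau> e' + 1" "\<tau> e' \<le> \<tau> e + 1"
      by (auto simp: close_sets_def nsets_def)
    have "\<not> e' \<subseteq> e" using card_subset_eq[of e e'] e e' ne by auto
    then obtain w where w: "w \<in> e'" "w \<notin> e" by blast
    define P where "P = Q - insert w e"
    have "card P = t - 3"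
      unfolding P_def using w e e' Q by (subst card_Diff_subset) auto
    then have "(e, w, P) \<in> ?S"
      using w e e' Q close by (auto simp: nsets_def W_def N_def P_def)
    moreover have "Q = ?f (e, w, P)" using w e e' by (auto simp: P_def)
    ultimately show "Q \<in> ?f ` ?S" by (rule rev_image_eqI)
  qed
  then have "card (close_sets V G \<tau> t) \<le> card ?S"
    using finS by (meson card_image_le card_mono finite_imageI order_trans)
  also have "\<dots> = (\<Sum>e\<in>nsets V 2. card (W e) * (card V choose (t - 3)))"
    using V finW by (simp add: finite_imp_finite_nsets card_cartesian_product)
  also have "\<dots> \<le> (\<Sum>e\<in>nsets V 2. 6 * card V ^ (t - 3))"
    using W choose_le_power by (intro sum_mono mult_mono) auto
  also have "\<dots> \<le> card V ^ 2 * (6 * card V ^ (t - 3))"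
    using choose_le_power[of "card V" 2] by simp
  also have "\<dots> = 6 * card V ^ (t - 1)"
  proof -
    have "t - 1 = 2 + (t - 3)" using t by simp
    then show ?thesis by (simp only: power_add mult.left_commute)
  qed
  finally show ?thesis .
qed

text \<open>Expand each square into ordered pairs \<open>(x, y)\<close> of common neighbours. The
  diagonal gives at most \<open>n ^ R * n\<close> triples. Off the diagonal, \<open>A\<close> with
  \<open>x\<close> and \<open>y\<close> is a close set, and each close set arises from at most
  \<open>(R + 2)^2\<close> triples.\<close>

lemma sum_power2_common_nbrs_upper:
  assumes V: "finite V" and G: "G \<subseteq> nsets V 2" and inj: "inj_on \<tau> G" and R: "1 \<le> R"
    and close: "\<And>Q p. Q \<in> nsets V (R + 2) \<Longrightarrow> p \<in> nsets Q 2 \<Longrightarrow> nsets Q 2 - {p} \<subseteq> G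
      \<Longrightarrow> Q \<in> close_sets V G \<tau> (R + 2)"
  shows "(\<Sum>A\<in>cliques V G R. (card (common_nbrs V G A))\<^sup>2)
    \<le> (1 + 6 * (R + 2)\<^sup>2) * card V ^ (R + 1)"
proof -
  let ?D = "common_nbrs V G"
  let ?T = "SIGMA A:cliques V G R. ?D A \<times> ?D A"
  let ?B = "close_sets V G \<tau> (R + 2)"
  have finB: "finite ?B" using V by (simp add: close_sets_def finite_imp_finite_nsets)
  have B: "finite Q \<and> card Q = R + 2" if "Q \<in> ?B" for Q
    using that by (auto simp: close_sets_def nsets_def)
  define diag where "diag = {(A, x, y) \<in> ?T. x = y}"
  define off where "off = {(A, x, y) \<in> ?T. x \<noteq> y}"
  have "card diag \<le> card (cliques V G R \<times> V)"
    using V by (intro card_inj_on_le[of "\<lambda>(A, x, y). (A, x)"])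
      (auto simp: diag_def inj_on_def common_nbrs_def finite_cliques)
  also have "\<dots> \<le> card V ^ R * card V"
  proof -
    have "card (cliques V G R) \<le> card (nsets V R)"
      using V by (intro card_mono) (auto simp: cliques_def finite_imp_finite_nsets)
    also have "\<dots> \<le> card V ^ R" using choose_le_power by simp
    finally show ?thesis by (simp add: card_cartesian_product)
  qed
  finally have diag: "card diag \<le> card V ^ (R + 1)" by (simp add: mult.commute)
  have "card off \<le> card (SIGMA Q:?B. Q \<times> Q)"
  proof (rule card_inj_on_le[of "\<lambda>(A, x, y). (insert x (insert y A), x, y)"])
    show "inj_on (\<lambda>(A, x, y). (insert x (insert y A), x, y)) off"
    proof (rule inj_on_inverseI[where g="\<lambda>(Q, x, y). (Q - {x, y}, x, y)"])
      fix z assume "z \<in> off"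
      then obtain A x y where z: "z = (A, x, y)" and xy: "x \<in> ?D A" "y \<in> ?D A"
        by (auto simp: off_def)
      then have "x \<notin> A" "y \<notin> A" using common_nbrs_notin[OF G] by blast+
      then have "insert x (insert y A) - {x, y} = A" by blast
      then show "(case case z of (A, x, y) \<Rightarrow> (insert x (insert y A), x, y) of
          (Q, x, y) \<Rightarrow> (Q - {x, y}, x, y)) = z"
        by (simp add: z)
    qed
    show "(\<lambda>(A, x, y). (insert x (insert y A), x, y)) ` off \<subseteq> (SIGMA Q:?B. Q \<times> Q)"
    proof (rule image_subsetI)
      fix z assume "z \<in> off"
      then obtain A x y where z: "z = (A, x, y)" and A: "A \<in> cliques V G R"
        and x: "x \<in> ?D A" and y: "y \<in> ?D A" and ne: "x \<noteq> y"
        by (auto simp: off_def)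
      let ?Q = "insert x (insert y A)"
      have nin: "x \<notin> A" "y \<notin> A" using x y common_nbrs_notin[OF G] by blast+
      have "?Q \<in> nsets V (R + 2)"
        using A x y ne nin by (auto simp: cliques_def nsets_def common_nbrs_def)
      moreover have "{x, y} \<in> nsets ?Q 2" using ne by (auto simp: nsets_def)
      \<comment> \<open>A pair other than \<open>{x, y}\<close> avoids \<open>x\<close> or
        \<open>y\<close>, so it lies in one of two cliques of size \<open>Suc R\<close>.\<close>
      moreover have "nsets ?Q 2 - {{x, y}} \<subseteq> G"
      proof
        fix e assume e: "e \<in> nsets ?Q 2 - {{x, y}}"
        have "insert x A \<in> cliques V G (Suc R)" "insert y A \<in> cliques V G (Suc R)"
          using insert_in_cliques[OF G A] x y by blast+
        moreover have "e \<in> nsets (insert x A) 2 \<or> e \<in> nsets (insert y A) 2"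
          using e by (auto simp: nsets_def card_2_iff)
        ultimately show "e \<in> G" by (auto simp: cliques_def)
      qed
      ultimately have "?Q \<in> ?B" by (rule close)
      then show "(case z of (A, x, y) \<Rightarrow> (insert x (insert y A), x, y)) \<in> (SIGMA Q:?B. Q \<times> Q)"
        by (simp add: z)
    qed
    show "finite (SIGMA Q:?B. Q \<times> Q)" using finB B by auto
  qed
  also have "\<dots> = (\<Sum>Q\<in>?B. card Q * card Q)"
    using finB B by (simp add: card_cartesian_product)
  also have "\<dots> = (\<Sum>Q\<in>?B. (R + 2)\<^sup>2)"
    using B by (intro sum.cong) (auto simp: power2_eq_square)
  also have "\<dots> \<le> 6 * card V ^ (R + 1) * (R + 2)\<^sup>2"
    using card_close_sets_le[OF V G inj, of "R + 2"] R by simp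
  finally have off: "card off \<le> 6 * card V ^ (R + 1) * (R + 2)\<^sup>2" .
  have "(\<Sum>A\<in>cliques V G R. (card (?D A))\<^sup>2) = card ?T"
    using V by (simp add: finite_cliques finite_common_nbrs card_cartesian_product power2_eq_square)
  also have "?T = diag \<union> off" by (auto simp: diag_def off_def)
  also have "card (diag \<union> off) \<le> card diag + card off" by (rule card_Un_le)
  finally show ?thesis using diag off by (simp add: algebra_simps)
qed

section \<open>The bootstrap process for complete graphs\<close>

lemma finite_copies:
  assumes "finite (verts H)" "finite (edges H)"
  shows "finite (copies F H)"
proof (rule finite_subset)
  show "copies F H \<subseteq> Pow (verts H) \<times> Pow (edges H)"
    by (auto simp: copies_def subhypergraph_def)
qed (use assms in auto)

lemma isomorphic_complete_graph:
  assumes "Q \<in> nsets V t"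
  shows "isomorphic (complete_graph t) (Q, nsets Q 2)"
proof -
  obtain f where f: "bij_betw f {..<t} Q"
    using assms finite_same_card_bij[of "{..<t}" Q] by (auto simp: nsets_def)
  have "(\<lambda>e. f ` e) ` nsets {..<t} 2 = nsets Q 2"
    using bij_betw_nsets[OF f, of 2] by (simp add: bij_betw_def)
  with f show ?thesis by (auto simp: isomorphic_def complete_graph_def)
qed

lemma kgraph_bootstrap_process:
  assumes "kgraph k H"
  shows "kgraph k (bootstrap_process k F H i)" "verts (bootstrap_process k F H i) = verts H"
  using assms by (induction i) (auto simp: bootstrap_process_def bootstrap_step_def kgraph_def)

lemma edges_bootstrap_process_mono:
  "i \<le> j \<Longrightarrow> edges (bootstrap_process k F H i) \<subseteq> edges (bootstrap_process k F H j)"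
  by (rule lift_Suc_mono_le[of "\<lambda>i. edges (bootstrap_process k F H i)"])
    (auto simp: bootstrap_process_def bootstrap_step_def)

text \<open>If \<open>p\<close> is not yet present, adding it keeps all old copies and creates the
  one on \<open>Q\<close>. The sets of copies are finite, so their number strictly
  increases.\<close>

lemma bootstrap_step_complete_graph:
  assumes H: "kgraph 2 H" and Q: "Q \<in> nsets (verts H) t" and p: "p \<in> nsets Q 2"
    and rest: "nsets Q 2 - {p} \<subseteq> edges H"
  shows "p \<in> edges (bootstrap_step 2 (complete_graph t) H)"
proof (cases "p \<in> edges H")
  case True
  then show ?thesis by (simp add: bootstrap_step_def)
next
  case False
  let ?F = "complete_graph t" and ?K = "(Q, nsets Q 2)"
  have fin: "finite (verts H)" "finite (edges H)"
    using H finite_imp_finite_nsets finite_subset by (auto simp: kgraph_def)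
  have "copies ?F H \<subseteq> copies ?F (add_edge H p)"
    by (auto simp: copies_def subhypergraph_def add_edge_def)
  moreover have "?K \<in> copies ?F (add_edge H p)"
    using Q rest isomorphic_complete_graph[OF Q]
    by (auto simp: copies_def subhypergraph_def add_edge_def nsets_def)
  moreover have "?K \<notin> copies ?F H"
    using False p by (auto simp: copies_def subhypergraph_def)
  ultimately have "copies ?F H \<subset> copies ?F (add_edge H p)" by blast
  then have "num_copies ?F H < num_copies ?F (add_edge H p)"
    unfolding num_copies_def using fin
    by (intro psubset_card_mono finite_copies) (auto simp: add_edge_def)
  moreover have "p \<in> nsets (verts H) 2" using p Q by (auto simp: nsets_def)
  ultimately show ?thesis by (simp add: bootstrap_step_def)
qed

section \<open>Infection times\<close>

text \<open>Initial edges get time \<open>0\<close>. The value is meaningful only for pairs that are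
  infected eventually, hence the existence hypotheses below.\<close>

definition infection_time :: "nat \<Rightarrow> 'b hypergraph \<Rightarrow> 'a hypergraph \<Rightarrow> 'a set \<Rightarrow> nat" where
  "infection_time k F H e = (LEAST i. e \<in> edges (bootstrap_process k F H i))"

lemma infection_time_le:
  "e \<in> edges (bootstrap_process k F H i) \<Longrightarrow> infection_time k F H e \<le> i"
  unfolding infection_time_def by (rule Least_le)

lemma infection_time_in:
  assumes "e \<in> edges (bootstrap_process k F H i)" "infection_time k F H e \<le> j"
  shows "e \<in> edges (bootstrap_process k F H j)"
  using LeastI[of "\<lambda>i. e \<in> edges (bootstrap_process k F H i)", OF assms(1)]
    edges_bootstrap_process_mono[OF assms(2), of k F H] by (auto simp: infection_time_def)

lemma infection_time_complete_graph:
  assumes H: "kgraph 2 H" and Q: "Q \<in> nsets (verts H) t" and p: "p \<in> nsets Q 2"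
    and inf: "\<And>e. e \<in> nsets Q 2 - {p} \<Longrightarrow> \<exists>i. e \<in> edges (bootstrap_process 2 (complete_graph t) H i)"
    and m: "\<And>e. e \<in> nsets Q 2 - {p} \<Longrightarrow> infection_time 2 (complete_graph t) H e \<le> m"
  shows "p \<in> edges (bootstrap_process 2 (complete_graph t) H (Suc m))"
proof -
  let ?H = "bootstrap_process 2 (complete_graph t) H"
  have "nsets Q 2 - {p} \<subseteq> edges (?H m)"
    using inf m infection_time_in by blast
  then have "p \<in> edges (bootstrap_step 2 (complete_graph t) (?H m))"
    using kgraph_bootstrap_process[OF H, of "complete_graph t" m] Q p
    by (intro bootstrap_step_complete_graph) simp_all
  then show ?thesis by (simp add: bootstrap_process_def)
qed

text \<open>The last infected pair of a \<open>t\<close>-set is infected at most one step after the last but one,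
  and at least one of these two pairs is not the missing pair \<open>p\<close>.\<close>

lemma near_clique_in_close_sets:
  fixes H :: "'a hypergraph" and t :: nat
  defines "\<tau> \<equiv> infection_time 2 (complete_graph t) H"
  assumes H: "kgraph 2 H" and t: "3 \<le> t"
    and G: "\<And>e. e \<in> G \<Longrightarrow> \<exists>i. e \<in> edges (bootstrap_process 2 (complete_graph t) H i)"
    and Q: "Q \<in> nsets (verts H) t" and p: "p \<in> nsets Q 2" and rest: "nsets Q 2 - {p} \<subseteq> G"
  shows "Q \<in> close_sets (verts H) G \<tau> t"
proof -
  let ?H = "bootstrap_process 2 (complete_graph t) H"
  have "finite Q" "card Q = t" using Q by (auto simp: nsets_def)
  then have fin: "finite (nsets Q 2)" and card: "card (nsets Q 2) = t choose 2"
    by (simp_all add: finite_imp_finite_nsets)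
  have "3 choose 2 \<le> t choose 2" using t by (rule binomial_right_mono)
  then have card3: "card (nsets Q 2) \<ge> 3" using card by (simp add: choose_two)
  have last: "\<exists>f\<in>nsets Q 2 - {e}. \<forall>e'\<in>nsets Q 2 - {e}. \<tau> e' \<le> \<tau> f" for e
  proof -
    have "nsets Q 2 - {e} \<noteq> {}"
    proof
      assume "nsets Q 2 - {e} = {}"
      then have "nsets Q 2 \<subseteq> {e}" by blast
      then have "card (nsets Q 2) \<le> card {e}" by (intro card_mono) auto
      with card3 show False by simp
    qed
    then have "Max (\<tau> ` (nsets Q 2 - {e})) \<in> \<tau> ` (nsets Q 2 - {e})"
      using fin by (intro Max_in) auto
    then obtain f where f: "f \<in> nsets Q 2 - {e}" "\<tau> f = Max (\<tau> ` (nsets Q 2 - {e}))"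
      by (metis imageE)
    have "\<tau> e' \<le> \<tau> f" if "e' \<in> nsets Q 2 - {e}" for e'
      unfolding f(2) using fin that by (intro Max_ge) auto
    with f(1) show ?thesis by (intro bexI[of _ f] ballI)
  qed
  \<comment> \<open>\<open>f\<close> is a last infected pair apart from \<open>p\<close>. If its
    time exceeds that of \<open>p\<close> by at most \<open>1\<close>, then \<open>p\<close> and
    \<open>f\<close> are the close pairs.\<close>
  obtain f where f: "f \<in> nsets Q 2 - {p}" "\<And>e. e \<in> nsets Q 2 - {p} \<Longrightarrow> \<tau> e \<le> \<tau> f"
    using last[of p] by metis
  have inf_p: "\<exists>i. e \<in> edges (?H i)" if "e \<in> nsets Q 2 - {p}" for e
    using G subsetD[OF rest that] .
  have pH: "p \<in> edges (?H (Suc (\<tau> f)))"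
    using infection_time_complete_graph[OF H Q p inf_p] f(2) by (simp add: \<tau>_def)
  then have pf: "\<tau> p \<le> \<tau> f + 1" unfolding \<tau>_def by (simp add: infection_time_le)
  have fG: "f \<in> G" using f(1) rest by (rule rev_subsetD)
  show ?thesis
  proof (cases "\<tau> f \<le> \<tau> p + 1")
    case True
    then show ?thesis using f(1) pf fG p Q by (intro close_setsI[of _ _ _ p f]) auto
  next
    case False
    \<comment> \<open>Now \<open>f\<close> comes later than \<open>p\<close>, so it is last in all
      of \<open>Q\<close>. The last pair \<open>g\<close> among the others precedes it by at most
      one step.\<close>
    obtain g where g: "g \<in> nsets Q 2 - {f}" "\<And>e. e \<in> nsets Q 2 - {f} \<Longrightarrow> \<tau> e \<le> \<tau> g"
      using last[of f] by metis
    have inf_f: "\<exists>i. e \<in> edges (?H i)" if "e \<in> nsets Q 2 - {f}" for e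
      using that inf_p[of e] pH by (cases "e = p") auto
    have "f \<in> edges (?H (Suc (\<tau> g)))"
      using infection_time_complete_graph[OF H Q _ inf_f] f(1) g(2) by (simp add: \<tau>_def)
    then have "\<tau> f \<le> \<tau> g + 1" unfolding \<tau>_def by (simp add: infection_time_le)
    moreover have "\<tau> g \<le> \<tau> f + 1"
      using f(2)[of g] g(1) False by (cases "g = p") auto
    ultimately show ?thesis using f(1) g(1) fG Q by (intro close_setsI[of _ _ _ g f]) auto
  qed
qed

text \<open>An edge that first appears in step \<open>i\<close> has infection time
  \<open>Suc i\<close>. One such edge per step therefore gives distinct labels, hence also
  \<open>m\<close> distinct edges.\<close>

lemma new_edges:
  assumes H: "kgraph k H"
    and m: "\<And>i. i < m \<Longrightarrow> bootstrap_process k F H i \<noteq> bootstrap_process k F H (Suc i)"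
  obtains G where "G \<subseteq> nsets (verts H) k" "card G = m" "inj_on (infection_time k F H) G"
    "\<And>e. e \<in> G \<Longrightarrow> \<exists>i. e \<in> edges (bootstrap_process k F H i)"
proof -
  let ?E = "\<lambda>i. edges (bootstrap_process k F H i)"
  have "\<exists>e. e \<in> ?E (Suc i) - ?E i" if "i < m" for i
  proof -
    have "?E i \<noteq> ?E (Suc i)"
      using m[OF that] kgraph_bootstrap_process(2)[OF H] by (metis prod_eqI)
    then show ?thesis using edges_bootstrap_process_mono[of i "Suc i" k F H] by auto
  qed
  then obtain e where e: "\<And>i. i < m \<Longrightarrow> e i \<in> ?E (Suc i) - ?E i" by metis
  have \<tau>: "infection_time k F H (e i) = Suc i" if "i < m" for i
    using e[OF that] infection_time_le[of "e i" k F H "Suc i"] infection_time_in[of "e i" k F H "Suc i" i]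
    by force
  show ?thesis
  proof
    show "e ` {..<m} \<subseteq> nsets (verts H) k"
      using e kgraph_bootstrap_process[OF H, of F] unfolding kgraph_def by fastforce
    show "card (e ` {..<m}) = m"
      using \<tau> by (subst card_image) (auto simp: inj_on_def, metis Suc_inject)
    show "inj_on (infection_time k F H) (e ` {..<m})"
      using \<tau> by (auto simp: inj_on_def)
    show "\<exists>i. e' \<in> ?E i" if "e' \<in> e ` {..<m}" for e'
      using that e by blast
  qed
qed

section \<open>Bounds on the running time\<close>

lemma bootstrap_process_running_time:
  assumes "i < running_time k F H"
  shows "bootstrap_process k F H i \<noteq> bootstrap_process k F H (Suc i)"
  using not_less_Least assms unfolding running_time_def by blast

text \<open>A crude bound that makes the set of running times finite, so that \<open>Max\<close> can
  be evaluated.\<close>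

lemma running_time_le:
  assumes H: "kgraph k H"
  shows "running_time k F H \<le> card (verts H) choose k"
proof -
  obtain G where "G \<subseteq> nsets (verts H) k" "card G = running_time k F H"
    using new_edges[OF H bootstrap_process_running_time] by metis
  then show ?thesis using H card_mono[of "nsets (verts H) k" G]
    by (simp add: kgraph_def finite_imp_finite_nsets)
qed

lemma max_running_time_le:
  assumes "\<And>H :: nat hypergraph. kgraph k H \<Longrightarrow> card (verts H) = n \<Longrightarrow> real (running_time k F H) \<le> c"
  shows "real (max_running_time k F n) \<le> c"
proof -
  let ?S = "{running_time k F H | H :: nat hypergraph. kgraph k H \<and> card (verts H) = n}"
  have "?S \<subseteq> {..n choose k}" using running_time_le[of k _ F] by auto
  then have "finite ?S" by (rule finite_subset) simp
  \<comment> \<open>The edgeless graph shows that the maximum is over a nonempty set.\<close>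
  moreover have "running_time k F ({..<n}, {}) \<in> ?S" by (force simp: kgraph_def)
  ultimately have "Max ?S \<in> ?S" by (intro Max_in) auto
  then show ?thesis using assms by (auto simp: max_running_time_def)
qed

text \<open>A longer process would yield a graph \<open>G\<close> above the threshold density. The
  sum of squares would then be of order at least \<open>n ^ (R + 2)\<close> by density and at most
  \<open>n ^ (R + 1)\<close> by closeness, which \<open>n\<close> is too large to allow.\<close>

lemma running_time_complete_graph_less:
  fixes \<delta> :: real
  assumes H: "kgraph 2 H" and R: "1 \<le> R" and \<delta>: "\<delta> > 0"
    and n: "fact R * (1 + 6 * (real R + 2)\<^sup>2) < \<delta> ^ (R + 1) * real (card (verts H))"
  shows "2 * real (running_time 2 (complete_graph (R + 2)) H)
    < (1 - 1 / real R + \<delta>) * (real (card (verts H)))\<^sup>2"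
proof (rule ccontr)
  assume *: "\<not> ?thesis"
  define V \<tau> where "V = verts H" and "\<tau> = infection_time 2 (complete_graph (R + 2)) H"
  obtain G where G: "G \<subseteq> nsets V 2" "card G = running_time 2 (complete_graph (R + 2)) H"
      "inj_on \<tau> G"
    and inf: "\<And>e. e \<in> G \<Longrightarrow> \<exists>i. e \<in> edges (bootstrap_process 2 (complete_graph (R + 2)) H i)"
    unfolding V_def \<tau>_def using new_edges[OF H bootstrap_process_running_time] by metis
  have dens: "(1 - 1 / real R + \<delta>) * (real (card V))\<^sup>2 \<le> 2 * real (card G)"
    using * G(2) by (simp add: V_def)
  have V: "finite V" using H by (simp add: V_def kgraph_def)
  have "0 \<le> fact R * (1 + 6 * (real R + 2)\<^sup>2)" by simp
  with n have "0 < \<delta> ^ (R + 1) * real (card V)" unfolding V_def by linarith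
  then have V0: "V \<noteq> {}" by auto
  then have pos: "0 < real (card V)" using V by (simp add: card_gt_0_iff)
  have "\<delta> ^ (R + 1) * real (card V) ^ (R + 2)
      \<le> fact R * real (\<Sum>A\<in>cliques V G R. (card (common_nbrs V G A))\<^sup>2)"
    using sum_power2_common_nbrs_lower[OF V V0 G(1) R \<delta> dens] by simp
  also have "\<dots> \<le> fact R * real ((1 + 6 * (R + 2)\<^sup>2) * card V ^ (R + 1))"
    using sum_power2_common_nbrs_upper[OF V G(1,3) R] near_clique_in_close_sets[OF H _ inf] R
    by (intro mult_left_mono of_nat_mono) (auto simp: V_def \<tau>_def)
  also have "\<dots> = fact R * (1 + 6 * (real R + 2)\<^sup>2) * real (card V) ^ (R + 1)"
    by (simp add: algebra_simps)
  finally have "(\<delta> ^ (R + 1) * real (card V)) * real (card V) ^ (R + 1)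
      \<le> fact R * (1 + 6 * (real R + 2)\<^sup>2) * real (card V) ^ (R + 1)"
    by (simp add: algebra_simps)
  then show False using n pos by (simp add: V_def)
qed

theorem theorem1p1:
  fixes t :: nat
  assumes "t \<ge> 3"
  shows "\<forall>\<epsilon>::real. \<epsilon> > 0 \<longrightarrow>
    (\<exists>n\<^sub>0::nat. \<forall>n\<ge>n\<^sub>0.
      real (max_running_time 2 (complete_graph t) n)
        \<le> ((real t - 3) / (real t - 2) + \<epsilon>) * real (n choose 2))"
proof (intro allI impI)
  fix \<epsilon> :: real assume \<epsilon>: "\<epsilon> > 0"
  define R where "R = t - 2"
  have R: "1 \<le> R" "t = R + 2" using assms by (auto simp: R_def)
  \<comment> \<open>Half of \<open>\<epsilon>\<close> goes into the density excess; the other half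
    absorbs the difference between \<open>n^2\<close> and \<open>2 * (n choose 2)\<close>.\<close>
  define \<delta> where "\<delta> = \<epsilon> / 2"
  have \<delta>: "\<delta> > 0" using \<epsilon> by (simp add: \<delta>_def)
  define c where "c = 1 - 1 / real R"
  define C where "C = fact R * (1 + 6 * (real R + 2)\<^sup>2)"
  have c: "c = (real t - 3) / (real t - 2)" using R by (simp add: c_def field_simps)
  \<comment> \<open>The first bound is the size condition of the running time estimate; the second
    gives \<open>(c + \<epsilon>) * n \<le> \<delta> * n^2\<close>, which pays for replacing
    \<open>n^2\<close> by \<open>n * (n - 1)\<close>.\<close>
  obtain n\<^sub>0 where n\<^sub>0: "real n\<^sub>0 > max (C / \<delta> ^ (R + 1)) ((c + \<epsilon>) / \<delta>)"
    using reals_Archimedean2 by blast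
  show "\<exists>n\<^sub>0. \<forall>n\<ge>n\<^sub>0. real (max_running_time 2 (complete_graph t) n)
      \<le> ((real t - 3) / (real t - 2) + \<epsilon>) * real (n choose 2)"
  proof (intro exI allI impI)
    fix n assume "n \<ge> n\<^sub>0"
    then have n: "C / \<delta> ^ (R + 1) < real n" "(c + \<epsilon>) / \<delta> < real n" using n\<^sub>0 by linarith+
    have "(c + \<epsilon>) * real n \<le> \<delta> * real n * real n"
      using n(2) \<delta> by (intro mult_right_mono) (auto simp: field_simps)
    then have "(c + \<delta>) * (real n)\<^sup>2 \<le> (c + \<epsilon>) * (real n * (real n - 1))"
      by (simp add: \<delta>_def power2_eq_square algebra_simps)
    also have "real n * (real n - 1) = 2 * real (n choose 2)"
      using choose_two[of n] by (cases n) (auto simp: real_of_nat_div algebra_simps)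
    finally have choose: "(c + \<delta>) * (real n)\<^sup>2 \<le> 2 * ((c + \<epsilon>) * real (n choose 2))"
      by simp
    have "C < \<delta> ^ (R + 1) * real n" using n(1) \<delta> by (simp add: field_simps)
    then show "real (max_running_time 2 (complete_graph t) n)
        \<le> ((real t - 3) / (real t - 2) + \<epsilon>) * real (n choose 2)"
      using running_time_complete_graph_less[OF _ R(1) \<delta>] choose
      unfolding c[symmetric] unfolding R(2) C_def c_def
      by (intro max_running_time_le) fastforce
  qed
qed

end
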